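(* Let $G$ be a finite connected graph, possibly with multiple edges but without loops, such that $2\leq d_G(v)\leq 3$ for every vertex $v\in V(G)$. If $G$ has an even number of edges, then the number of perfect matchings of the line graph $L(G)$ equals $2^{n/2+1}$, where $n$ is the number of vertices of degree $3$ in $G$.
   Context: $d_G(v)$ denotes the degree of $v$ in $G$, with multiple edges counted according to multiplicity. For a graph $G$ (possibly with multiple edges, no loops), the line graph $L(G)$ is the graph with vertex set $E(G)$ in which two distinct vertices $e,f$ are joined by exactly $i$ edges ($i=0,1,2$) if and only if the edges $e$ and $f$ of $G$ have exactly $i$ end vertices in common. A perfect matching is a set of pairwise disjoint edges covering all vertices; parallel edges are distinct edges, so they give distinct perfect matchings. *)

theory Defs
  imports Complex_Main
begin

text \<open>
  Undirected graphs with named edges: parallel edges are distinct elements of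
  \<open>edges G\<close> with the same set of end vertices, and looplessness is the requirement
  that every edge has exactly two end vertices.
\<close>

record ('v, 'e) multigraph =
  verts :: "'v set"
  edges :: "'e set"
  ends :: "'e \<Rightarrow> 'v set"

definition loopless_multigraph :: "('v, 'e) multigraph \<Rightarrow> bool" where
  "loopless_multigraph G \<longleftrightarrow>
     (\<forall>e\<in>edges G. ends G e \<subseteq> verts G \<and> card (ends G e) = 2)"

definition finite_multigraph :: "('v, 'e) multigraph \<Rightarrow> bool" where
  "finite_multigraph G \<longleftrightarrow> finite (verts G) \<and> finite (edges G)"

definition degree :: "('v, 'e) multigraph \<Rightarrow> 'v \<Rightarrow> nat" where
  "degree G v = card {e \<in> edges G. v \<in> ends G e}"

definition adjacent :: "('v, 'e) multigraph \<Rightarrow> 'v \<Rightarrow> 'v \<Rightarrow> bool" where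
  "adjacent G u v \<longleftrightarrow> (\<exists>e\<in>edges G. ends G e = {u, v})"

text \<open>Connected graphs are nonempty by convention.\<close>

definition connected_multigraph :: "('v, 'e) multigraph \<Rightarrow> bool" where
  "connected_multigraph G \<longleftrightarrow>
     verts G \<noteq> {} \<and> (\<forall>u\<in>verts G. \<forall>v\<in>verts G. (adjacent G)\<^sup>*\<^sup>* u v)"

text \<open>
  Distinct edges \<open>e\<close>, \<open>f\<close> of \<open>G\<close> are joined in the line graph by one edge for each
  common end vertex \<open>v\<close>; that edge is named by the pair \<open>({e, f}, v)\<close>.
\<close>

definition line_graph :: "('v, 'e) multigraph \<Rightarrow> ('e, 'e set \<times> 'v) multigraph" where
  "line_graph G =
     \<lparr> verts = edges G,
       edges = {({e, f}, v) | e f v.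
                  e \<in> edges G \<and> f \<in> edges G \<and> e \<noteq> f \<and> v \<in> ends G e \<inter> ends G f},
       ends = fst \<rparr>"

definition perfect_matching :: "('v, 'e) multigraph \<Rightarrow> 'e set \<Rightarrow> bool" where
  "perfect_matching G M \<longleftrightarrow>
     M \<subseteq> edges G \<and>
     pairwise (\<lambda>a b. ends G a \<inter> ends G b = {}) M \<and>
     (\<Union>a\<in>M. ends G a) = verts G"

lemma loopless_line_graph: "loopless_multigraph (line_graph G)"
  by (auto simp: loopless_multigraph_def line_graph_def)

lemma line_graph_multiplicity:
  assumes "e \<in> edges G" "f \<in> edges G" "e \<noteq> f"
  shows "card {x \<in> edges (line_graph G). ends (line_graph G) x = {e, f}}
           = card (ends G e \<inter> ends G f)"
proof -
  have "{x \<in> edges (line_graph G). ends (line_graph G) x = {e, f}}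
          = Pair {e, f} ` (ends G e \<inter> ends G f)"
    using assms by (auto simp: line_graph_def doubleton_eq_iff image_iff)
  then show ?thesis
    by (simp add: card_image inj_on_def)
qed

end

theory Submission
  imports Defs "HOL-Library.FuncSet"
begin

text \<open>
  Since every degree is at most 3, a perfect matching of the line graph uses at most one pair of
  edges at each vertex. Directing every edge towards the vertex at which it is matched therefore
  identifies the perfect matchings with the orientations of \<open>G\<close> all of whose in-degrees are even.
  Reversing the edges of a path toggles the in-degree parities of exactly its two end vertices; so,
  in a connected graph, the parities at all vertices but a fixed one are equidistributed over the
  \<open>2 ^ card (edges G)\<close> orientations, and the parity at the fixed vertex is then determined by
  the number of edges. This gives \<open>2 ^ (card (edges G) - card (verts G) + 1)\<close> orientations, and
  counting degrees gives \<open>2 * card (edges G) = 2 * card (verts G) + n\<close>.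
\<close>

section \<open>Orientations and in-degrees\<close>

text \<open>An orientation maps every edge to its head.\<close>

definition orientations :: "('v, 'e) multigraph \<Rightarrow> ('e \<Rightarrow> 'v) set" where
  "orientations G = PiE (edges G) (ends G)"

definition in_edges :: "('v, 'e) multigraph \<Rightarrow> ('e \<Rightarrow> 'v) \<Rightarrow> 'v \<Rightarrow> 'e set" where
  "in_edges G r v = {e \<in> edges G. r e = v}"

definition even_orientations :: "('v, 'e) multigraph \<Rightarrow> ('e \<Rightarrow> 'v) set" where
  "even_orientations G = {r \<in> orientations G. \<forall>v. even (card (in_edges G r v))}"

lemma card_orientations:
  assumes "loopless_multigraph G" "finite_multigraph G"
  shows "card (orientations G) = 2 ^ card (edges G)"
  using assms
  by (simp add: orientations_def card_PiE finite_multigraph_def loopless_multigraph_def)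

lemma finite_orientations:
  assumes "loopless_multigraph G" "finite_multigraph G"
  shows "finite (orientations G)"
  using card_orientations[OF assms] card.infinite by fastforce

lemma orientation_in_ends: "r \<in> orientations G \<Longrightarrow> e \<in> edges G \<Longrightarrow> r e \<in> ends G e"
  by (auto simp: orientations_def)

lemma in_edges_subset: "r \<in> orientations G \<Longrightarrow> in_edges G r v \<subseteq> {e \<in> edges G. v \<in> ends G e}"
  by (auto simp: orientations_def in_edges_def)

lemma sum_card_in_edges:
  assumes "loopless_multigraph G" "finite_multigraph G" "r \<in> orientations G"
  shows "(\<Sum>v\<in>verts G. card (in_edges G r v)) = card (edges G)"
proof -
  have "edges G = (\<Union>v\<in>verts G. in_edges G r v)"
    using assms orientation_in_ends[OF assms(3)]
    by (auto simp: in_edges_def loopless_multigraph_def)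
  moreover have "card (\<Union>v\<in>verts G. in_edges G r v) = (\<Sum>v\<in>verts G. card (in_edges G r v))"
    using assms(2) by (intro card_UN_disjoint) (auto simp: in_edges_def finite_multigraph_def)
  ultimately show ?thesis by simp
qed

section \<open>Changing in-degree parities by reversal\<close>

text \<open>Reversal moves \<open>e\<close> from the in-edges of one end to those of the other. The
  formula \<open>w = x \<longleftrightarrow> w = y\<close> fails exactly at the two ends, so it
  encodes "toggle at \<open>x\<close> and \<open>y\<close> only".\<close>

lemma parity_in_edges_reverse:
  assumes "finite (edges G)" "e \<in> edges G" "x \<noteq> y" "r e \<in> {x, y}"
  defines "r' \<equiv> r(e := if r e = x then y else x)"
  shows "odd (card (in_edges G r' w)) \<longleftrightarrow> (odd (card (in_edges G r w)) \<longleftrightarrow> (w = x \<longleftrightarrow> w = y))"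
proof -
  define D where "D = {f \<in> edges G - {e}. r f = w}"
  have "finite D" "e \<notin> D" using assms(1) by (auto simp: D_def)
  moreover have "in_edges G r w = (if r e = w then insert e D else D)"
    using assms(2) by (auto simp: in_edges_def D_def)
  moreover have "in_edges G r' w = (if r' e = w then insert e D else D)"
    using assms(2) by (auto simp: in_edges_def D_def r'_def)
  ultimately show ?thesis using assms(3,4) by (auto simp: r'_def)
qed

text \<open>Induction along a path from \<open>u\<close>: extending it by an edge from
  \<open>y\<close> to \<open>z\<close> toggles \<open>y\<close> a second time, which cancels, and
  leaves \<open>u\<close> and \<open>z\<close>. For \<open>u = v\<close> nothing is toggled.\<close>

lemma toggle_parities:
  assumes "loopless_multigraph G" "finite_multigraph G" "(adjacent G)\<^sup>*\<^sup>* u v"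
  shows "\<exists>\<phi>. bij_betw \<phi> (orientations G) (orientations G) \<and>
    (\<forall>r\<in>orientations G. \<forall>w. odd (card (in_edges G (\<phi> r) w)) \<longleftrightarrow>
       (odd (card (in_edges G r w)) \<longleftrightarrow> (w = u \<longleftrightarrow> w = v)))"
  using assms(3)
proof (induction rule: rtranclp_induct)
  case base
  show ?case by (rule exI[of _ id]) (auto simp: bij_betw_def)
next
  case (step y z)
  obtain \<phi> where \<phi>: "bij_betw \<phi> (orientations G) (orientations G)"
    "\<And>r w. r \<in> orientations G \<Longrightarrow> odd (card (in_edges G (\<phi> r) w)) \<longleftrightarrow>
       (odd (card (in_edges G r w)) \<longleftrightarrow> (w = u \<longleftrightarrow> w = y))"
    using step.IH by blast
  obtain e where e: "e \<in> edges G" "ends G e = {y, z}"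
    using step.hyps by (auto simp: adjacent_def)
  have "y \<noteq> z"
    using assms(1) e by (force simp: loopless_multigraph_def)
  \<comment> \<open>Reversal of \<open>e\<close> is its own inverse on orientations, hence a
    bijection.\<close>
  define \<psi> where "\<psi> r = r(e := if r e = y then z else y)" for r
  have in_yz: "r e \<in> {y, z}" if "r \<in> orientations G" for r
    using orientation_in_ends[OF that e(1)] e(2) by simp
  have "\<psi> r \<in> orientations G" if "r \<in> orientations G" for r
    using that e by (auto simp: \<psi>_def orientations_def PiE_iff extensional_def)
  moreover have "\<psi> (\<psi> r) = r" if "r \<in> orientations G" for r
    using in_yz[OF that] \<open>y \<noteq> z\<close> by (auto simp: \<psi>_def)
  ultimately have "bij_betw \<psi> (orientations G) (orientations G)"
    by (intro bij_betw_byWitness[where f' = \<psi>]) auto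
  then have "bij_betw (\<psi> \<circ> \<phi>) (orientations G) (orientations G)"
    using \<phi>(1) by (rule bij_betw_trans[rotated])
  moreover have "odd (card (in_edges G ((\<psi> \<circ> \<phi>) r) w)) \<longleftrightarrow>
      (odd (card (in_edges G r w)) \<longleftrightarrow> (w = u \<longleftrightarrow> w = z))" if r: "r \<in> orientations G" for r w
  proof -
    have "\<phi> r \<in> orientations G" using \<phi>(1) r bij_betwE by blast
    then have "odd (card (in_edges G (\<psi> (\<phi> r)) w)) \<longleftrightarrow>
        (odd (card (in_edges G (\<phi> r) w)) \<longleftrightarrow> (w = y \<longleftrightarrow> w = z))"
      using assms(2) e(1) \<open>y \<noteq> z\<close> in_yz unfolding \<psi>_def
      by (intro parity_in_edges_reverse) (auto simp: finite_multigraph_def)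
    then show ?thesis using \<phi>(2)[OF r, of w] by auto
  qed
  ultimately show ?case by blast
qed

section \<open>Counting even orientations\<close>

text \<open>Toggling along a path from \<open>u\<close> to \<open>v0\<close> changes the recorded
  odd set only at \<open>u\<close>, because \<open>v0\<close> is left out of it. This matches the
  orientations for \<open>U\<close> with those for \<open>insert u U\<close>.\<close>

lemma card_orientations_parity:
  assumes "loopless_multigraph G" "finite_multigraph G" "connected_multigraph G"
    and "v0 \<in> verts G" "U \<subseteq> verts G - {v0}"
  shows "card {r \<in> orientations G. {v \<in> verts G - {v0}. odd (card (in_edges G r v))} = U}
       = card {r \<in> orientations G. {v \<in> verts G - {v0}. odd (card (in_edges G r v))} = {}}"
    (is "card (?F U) = _")
proof -
  have "finite U"
    using assms(2,5) finite_subset by (fastforce simp: finite_multigraph_def)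
  then show ?thesis using assms(5)
  proof (induction U rule: finite_induct)
    case (insert u U)
    have "(adjacent G)\<^sup>*\<^sup>* u v0"
      using assms(3,4) insert.prems by (auto simp: connected_multigraph_def)
    from toggle_parities[OF assms(1,2) this]
    obtain \<phi> where \<phi>: "bij_betw \<phi> (orientations G) (orientations G)"
      "\<And>r w. r \<in> orientations G \<Longrightarrow> odd (card (in_edges G (\<phi> r) w)) \<longleftrightarrow>
         (odd (card (in_edges G r w)) \<longleftrightarrow> (w = u \<longleftrightarrow> w = v0))"
      by blast
    have iff: "\<phi> r \<in> ?F (insert u U) \<longleftrightarrow> r \<in> ?F U" if r: "r \<in> orientations G" for r
    proof -
      have "\<phi> r \<in> orientations G" using \<phi>(1) r bij_betwE by blast
      moreover have "{v \<in> verts G - {v0}. odd (card (in_edges G (\<phi> r) v))} =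
          {v \<in> verts G - {v0}. odd (card (in_edges G r v)) \<longleftrightarrow> v \<noteq> u}"
        using \<phi>(2)[OF r] by auto
      \<comment> \<open>Membership of \<open>u\<close> is flipped; as \<open>u \<notin> U\<close>
        and \<open>u\<close> lies in \<open>verts G - {v0}\<close>, the flipped set is
        \<open>insert u U\<close> exactly when the original is \<open>U\<close>.\<close>
      moreover have "{v \<in> verts G - {v0}. odd (card (in_edges G r v)) \<longleftrightarrow> v \<noteq> u} = insert u U \<longleftrightarrow>
          {v \<in> verts G - {v0}. odd (card (in_edges G r v))} = U"
        using insert.hyps(2) insert.prems by blast
      ultimately show ?thesis using r by (simp only: mem_Collect_eq simp_thms)
    qed
    have "\<phi> ` ?F U = ?F (insert u U)"
    proof (intro equalityI subsetI)
      fix s assume s: "s \<in> ?F (insert u U)"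
      then obtain r where "r \<in> orientations G" "s = \<phi> r"
        using bij_betw_imp_surj_on[OF \<phi>(1)] by blast
      then show "s \<in> \<phi> ` ?F U" using s iff by blast
    qed (use iff in blast)
    moreover have "inj_on \<phi> (?F U)"
      using \<phi>(1) by (auto simp: bij_betw_def intro: inj_on_subset)
    ultimately have "card (?F (insert u U)) = card (?F U)"
      by (metis (no_types, lifting) card_image)
    then show ?case using insert by simp
  qed simp
qed

text \<open>The orientations split into equally large classes, one for each subset of
  \<open>verts G - {v0}\<close>. The product form avoids division in the naturals.\<close>

lemma card_even_orientations:
  assumes "loopless_multigraph G" "finite_multigraph G" "connected_multigraph G"
    and "even (card (edges G))"
  shows "2 ^ (card (verts G) - 1) * card (even_orientations G) = 2 ^ card (edges G)"
proof -
  obtain v0 where v0: "v0 \<in> verts G"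
    using assms(3) by (auto simp: connected_multigraph_def)
  have fin: "finite (verts G)" using assms(2) by (simp add: finite_multigraph_def)
  define S where "S r = {v \<in> verts G - {v0}. odd (card (in_edges G r v))}" for r
  let ?F = "\<lambda>U. {r \<in> orientations G. S r = U}"
  have "S r \<in> Pow (verts G - {v0})" for r by (auto simp: S_def)
  then have "orientations G = (\<Union>U\<in>Pow (verts G - {v0}). ?F U)" by blast
  then have "card (orientations G) = card (\<Union>U\<in>Pow (verts G - {v0}). ?F U)"
    by simp
  also have "\<dots> = (\<Sum>U\<in>Pow (verts G - {v0}). card (?F U))"
    using fin finite_orientations[OF assms(1,2)] by (intro card_UN_disjoint) auto
  also have "\<dots> = (\<Sum>U\<in>Pow (verts G - {v0}). card (?F {}))"
    by (intro sum.cong refl card_orientations_parity[OF assms(1-3) v0, folded S_def]) blast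
  also have "\<dots> = 2 ^ (card (verts G) - 1) * card (?F {})"
    using fin v0 by (simp add: card_Pow)
  also have "?F {} = even_orientations G"
  proof (intro equalityI subsetI)
    fix r assume r: "r \<in> ?F {}"
    then have ro: "r \<in> orientations G" by simp
    have ev: "even (card (in_edges G r v))" if "v \<in> verts G" "v \<noteq> v0" for v
      using r that by (auto simp: S_def)
    have "(\<Sum>v\<in>verts G. card (in_edges G r v)) =
        card (in_edges G r v0) + (\<Sum>v\<in>verts G - {v0}. card (in_edges G r v))"
      using fin v0 by (rule sum.remove)
    \<comment> \<open>The in-degrees sum to the even number of edges, so the parity at
      \<open>v0\<close> is forced.\<close>
    moreover have "even (\<Sum>v\<in>verts G - {v0}. card (in_edges G r v))"
      using ev by (intro dvd_sum) auto
    ultimately have "even (card (in_edges G r v0))"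
      using sum_card_in_edges[OF assms(1,2) ro] assms(4) by (metis even_add)
    moreover have "in_edges G r v = {}" if "v \<notin> verts G" for v
      using that assms(1) in_edges_subset[OF ro, of v] by (auto simp: loopless_multigraph_def)
    ultimately have "even (card (in_edges G r v))" for v
      using ev by (cases "v \<in> verts G"; cases "v = v0") auto
    with ro show "r \<in> even_orientations G" by (simp add: even_orientations_def)
  qed (auto simp: even_orientations_def S_def)
  finally show ?thesis using card_orientations[OF assms(1,2)] by simp
qed

section \<open>Perfect matchings as even orientations\<close>

definition matching_of :: "('v, 'e) multigraph \<Rightarrow> ('e \<Rightarrow> 'v) \<Rightarrow> ('e set \<times> 'v) set" where
  "matching_of G r = {(in_edges G r v, v) | v. in_edges G r v \<noteq> {}}"

lemma edges_line_graph_iff: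
  "(A, v) \<in> edges (line_graph G) \<longleftrightarrow> card A = 2 \<and> A \<subseteq> {e \<in> edges G. v \<in> ends G e}"
  by (auto simp: line_graph_def card_2_iff)

lemma ends_line_graph [simp]: "ends (line_graph G) = fst"
  and verts_line_graph [simp]: "verts (line_graph G) = edges G"
  by (simp_all add: line_graph_def)

text \<open>Every edge has exactly one head, so the sets of in-edges are disjoint and cover
  \<open>edges G\<close>; it remains to see that the nonempty ones are pairs.\<close>

lemma perfect_matching_matching_of:
  assumes "finite_multigraph G" "\<forall>v\<in>verts G. degree G v \<le> 3" "loopless_multigraph G"
    and r: "r \<in> even_orientations G"
  shows "perfect_matching (line_graph G) (matching_of G r)"
proof -
  have ro: "r \<in> orientations G" and ev: "even (card (in_edges G r v))" for v
    using r by (auto simp: even_orientations_def)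
  have "(in_edges G r v, v) \<in> edges (line_graph G)" if ne: "in_edges G r v \<noteq> {}" for v
  proof -
    have sub: "in_edges G r v \<subseteq> {e \<in> edges G. v \<in> ends G e}" using ro by (rule in_edges_subset)
    then have "v \<in> verts G" using ne assms(3) by (auto simp: loopless_multigraph_def)
    moreover have "finite {e \<in> edges G. v \<in> ends G e}"
      using assms(1) by (simp add: finite_multigraph_def)
    ultimately have "card (in_edges G r v) \<le> 3" "card (in_edges G r v) \<noteq> 0"
      using card_mono[OF _ sub] assms(2) ne finite_subset[OF sub]
      by (fastforce simp: degree_def)+
    \<comment> \<open>Even, nonzero and at most 3 leaves only 2.\<close>
    with ev[of v] have "card (in_edges G r v) = 2" by (auto elim!: evenE)
    with sub show ?thesis by (simp add: edges_line_graph_iff)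
  qed
  then show ?thesis
    by (fastforce simp: perfect_matching_def matching_of_def pairwise_def in_edges_def)
qed

text \<open>The head of \<open>e\<close> can be read off as the second component of the pair whose
  first component contains \<open>e\<close>.\<close>

lemma inj_on_matching_of: "inj_on (matching_of G) (orientations G)"
proof (rule inj_onI)
  fix r s assume rs: "r \<in> orientations G" "s \<in> orientations G" "matching_of G r = matching_of G s"
  have "r e = s e" if e: "e \<in> edges G" for e
  proof -
    have "(in_edges G r (r e), r e) \<in> matching_of G r"
      using e by (auto simp: matching_of_def in_edges_def)
    then have "in_edges G r (r e) = in_edges G s (r e)"
      unfolding rs(3) by (auto simp: matching_of_def)
    moreover have "e \<in> in_edges G r (r e)" using e by (simp add: in_edges_def)
    ultimately show ?thesis by (simp add: in_edges_def)
  qed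
  then show "r = s" using rs(1,2) by (auto simp: orientations_def intro: PiE_ext)
qed

lemma perfect_matching_is_matching_of:
  assumes "finite_multigraph G" "\<forall>v\<in>verts G. degree G v \<le> 3" "loopless_multigraph G"
    and M: "perfect_matching (line_graph G) M"
  shows "M \<in> matching_of G ` even_orientations G"
proof -
  have edge: "card A = 2" "A \<subseteq> {e \<in> edges G. v \<in> ends G e}" if "(A, v) \<in> M" for A v
    using M that edges_line_graph_iff[of A v G] by (auto simp: perfect_matching_def)
  have disj: "a = b" if "a \<in> M" "b \<in> M" "e \<in> fst a" "e \<in> fst b" for a b e
    using M that by (auto simp: perfect_matching_def pairwise_def)
  have cover: "\<exists>A v. (A, v) \<in> M \<and> e \<in> A" if "e \<in> edges G" for e
    using M that by (fastforce simp: perfect_matching_def)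
  \<comment> \<open>Two distinct matching edges at \<open>v\<close> would be disjoint pairs, forcing
    degree at least 4.\<close>
  have at_most_one: "A = B" if AB: "(A, v) \<in> M" "(B, v) \<in> M" for A B v
  proof (rule ccontr)
    assume "A \<noteq> B"
    then have "A \<inter> B = {}" using disj[OF AB] by auto
    then have "card (A \<union> B) = 4"
      using edge(1)[OF AB(1)] edge(1)[OF AB(2)] by (simp add: card_Un_disjoint card_ge_0_finite)
    moreover have "card (A \<union> B) \<le> degree G v"
      unfolding degree_def using edge(2)[OF AB(1)] edge(2)[OF AB(2)] assms(1)
      by (intro card_mono) (auto simp: finite_multigraph_def)
    moreover have "v \<in> verts G"
      using edge[OF AB(1)] assms(3) by (fastforce simp: loopless_multigraph_def card_2_iff)
    ultimately show False using assms(2) by fastforce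
  qed
  \<comment> \<open>The head of \<open>e\<close> is the vertex at which \<open>e\<close> is matched:
    it exists by \<open>cover\<close>, and \<open>disj\<close> makes it unique, so the choice is
    harmless.\<close>
  define r where "r = restrict (\<lambda>e. SOME v. \<exists>A. (A, v) \<in> M \<and> e \<in> A) (edges G)"
  have r_in: "\<exists>A. (A, r e) \<in> M \<and> e \<in> A" if "e \<in> edges G" for e
    using someI_ex[of "\<lambda>v. \<exists>A. (A, v) \<in> M \<and> e \<in> A"] cover[OF that] that by (auto simp: r_def)
  have r_eq: "r e = v" if "(A, v) \<in> M" "e \<in> A" for A e v
    using r_in[of e] edge(2)[OF that(1)] disj[OF that(1)] that(2) by fastforce
  have in_r: "in_edges G r v = A" if Av: "(A, v) \<in> M" for A v
  proof (intro equalityI subsetI)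
    fix e assume "e \<in> in_edges G r v"
    then have "\<exists>B. (B, v) \<in> M \<and> e \<in> B" using r_in[of e] by (auto simp: in_edges_def)
    then show "e \<in> A" using at_most_one[OF Av] by blast
  next
    fix e assume "e \<in> A"
    then show "e \<in> in_edges G r v" using r_eq[OF Av] edge(2)[OF Av] by (auto simp: in_edges_def)
  qed
  have in_M: "(in_edges G r v, v) \<in> M" if "in_edges G r v \<noteq> {}" for v
  proof -
    from that obtain A where "(A, v) \<in> M" using r_in by (fastforce simp: in_edges_def)
    with in_r show ?thesis by metis
  qed
  have "r \<in> orientations G"
    unfolding orientations_def
  proof (rule PiE_I)
    fix e assume "e \<in> edges G"
    then show "r e \<in> ends G e" using r_in edge(2) by blast
  qed (simp add: r_def)
  moreover have "even (card (in_edges G r v))" for v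
    using in_M[of v] edge(1)[of "in_edges G r v" v] by (cases "in_edges G r v = {}") auto
  moreover have "M = matching_of G r"
  proof (intro equalityI subsetI)
    fix a assume a: "a \<in> M"
    obtain A v where Av: "a = (A, v)" by (cases a)
    have "in_edges G r v = A" "A \<noteq> {}" using a in_r[of A v] edge(1)[of A v] unfolding Av by auto
    then show "a \<in> matching_of G r" unfolding Av matching_of_def by blast
  qed (use in_M in \<open>unfold matching_of_def, blast\<close>)
  ultimately show ?thesis by (auto simp: even_orientations_def)
qed

lemma card_perfect_matching_line_graph:
  assumes "finite_multigraph G" "\<forall>v\<in>verts G. degree G v \<le> 3" "loopless_multigraph G"
  shows "card {M. perfect_matching (line_graph G) M} = card (even_orientations G)"
proof -
  have "{M. perfect_matching (line_graph G) M} = matching_of G ` even_orientations G"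
    using perfect_matching_matching_of[OF assms] perfect_matching_is_matching_of[OF assms] by blast
  moreover have "inj_on (matching_of G) (even_orientations G)"
    by (rule inj_on_subset[OF inj_on_matching_of]) (auto simp: even_orientations_def)
  ultimately show ?thesis by (simp add: card_image)
qed

section \<open>Degree count and conclusion\<close>

lemma sum_degree:
  assumes "loopless_multigraph G" "finite_multigraph G"
  shows "(\<Sum>v\<in>verts G. degree G v) = 2 * card (edges G)"
proof -
  have "{v \<in> verts G. v \<in> ends G e} = ends G e" if "e \<in> edges G" for e
    using assms(1) that by (auto simp: loopless_multigraph_def)
  then have "\<forall>e\<in>edges G. card {v \<in> verts G. v \<in> ends G e} = 2"
    using assms(1) by (simp add: loopless_multigraph_def)
  then show ?thesis
    using sum_multicount[of "verts G" "edges G" "\<lambda>v e. v \<in> ends G e" 2] assms(2)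
    by (simp add: degree_def finite_multigraph_def)
qed

theorem theorem2p4:
  fixes G :: "('v, 'e) multigraph" and n :: nat
  assumes "loopless_multigraph G"
    and "finite_multigraph G"
    and "connected_multigraph G"
    and "\<forall>v\<in>verts G. 2 \<le> degree G v \<and> degree G v \<le> 3"
    and "even (card (edges G))"
    and "n = card {v \<in> verts G. degree G v = 3}"
  shows "real (card {M. perfect_matching (line_graph G) M}) = 2 powr (real n / 2 + 1)"
proof -
  let ?V = "card (verts G)" and ?E = "card (edges G)"
  have fin: "finite (verts G)" using assms(2) by (simp add: finite_multigraph_def)
  then have "?V > 0" using assms(3) by (simp add: connected_multigraph_def card_gt_0_iff)
  have "2 * ?E = (\<Sum>v\<in>verts G. degree G v)"
    using sum_degree[OF assms(1,2)] by simp
  also have "\<dots> = (\<Sum>v\<in>verts G. 2 + of_bool (degree G v = 3))"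
    using assms(4) by (intro sum.cong) force+
  also have "\<dots> = 2 * ?V + n"
    using fin by (simp only: sum.distrib sum_of_bool_eq assms(6)) (simp add: Int_def)
  finally have "2 * ?E = 2 * ?V + n" .
  \<comment> \<open>\<open>?V - 1\<close> is a subtraction of naturals; \<open>?V > 0\<close> makes
    it agree with the real one.\<close>
  then have "real n / 2 + 1 = real ?E - real (?V - 1)"
    using \<open>?V > 0\<close> by linarith
  then have "2 powr (real n / 2 + 1) = 2 ^ ?E / (2 ^ (?V - 1) :: real)"
    by (simp add: powr_diff powr_realpow)
  also have "\<dots> = real (card (even_orientations G))"
    using card_even_orientations[OF assms(1-3,5), THEN arg_cong[of _ _ real]]
    by (simp add: field_simps)
  finally show ?thesis
    using card_perfect_matching_line_graph[OF assms(2) _ assms(1)] assms(4) by simp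
qed

end
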